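(* Let $l\ge 1$ be an integer. For every complex $s$ with $\operatorname{Re}(s)>1$, $$\sum_{n=1}^\infty a_l(n)\,n^{-s}=\left(\prod_{n=2}^\infty (1-n^{-s})^{-1}-1\right)^l .$$ Consequently $a_l=\bar f^{*l}$, where $\bar f(1)=0$ and $\bar f(n)=f(n)$ for $n\ge 2$. Analogously, $b_l=\bar g^{*l}$, where $\bar g(1)=0$ and $\bar g(n)=g(n)$ for $n\ge 2$.
   Context: For an integer $l\ge 1$, an $l$-colored part is a pair $(d,c)$ with $d\ge 2$ an integer (its value) and $c\in\{1,\dots,l\}$ (its color). An unordered $l$-colored factorization of an integer $n\ge 2$ is a finite multiset of $l$-colored parts whose values (with multiplicity) have product $n$ (one-part factorizations are included). It is called distinct if no pair $(d,c)$ occurs more than once. For $n\ge 2$, $a_l(n)$ (respectively $b_l(n)$) is the number of unordered (respectively distinct unordered) $l$-colored factorizations of $n$ that use exactly $l$ colors, i.e. in which each of the colors $1,\dots,l$ is the color of at least one part; and $a_l(1)=b_l(1)=0$ for $l\ge 1$. For $n\ge 2$, $f(n)$ (respectively $g(n)$) is the number of uncolored unordered factorizations of $n$ into parts $\ge 2$ (respectively into distinct parts $\ge 2$). For an arithmetic function $\phi$, $\phi^{*l}$ denotes its $l$-fold Dirichlet convolution with itself: $\phi^{*1}=\phi$ and $\phi^{*l}=\phi^{*(l-1)}*\phi$ for $l\ge 2$, where $(\phi*\psi)(n)=\sum_{n_1n_2=n}\phi(n_1)\psi(n_2)$. *)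

theory Defs
  imports "HOL-Analysis.Analysis" "HOL-Library.Multiset"
begin

definition factorizations :: "nat \<Rightarrow> nat multiset set" where
  "factorizations n = {M. (\<forall>d\<in>#M. d \<ge> 2) \<and> prod_mset M = n}"

(* A colored part is a pair (value, color). *)
definition colored_factorizations :: "nat \<Rightarrow> nat \<Rightarrow> (nat \<times> nat) multiset set" where
  "colored_factorizations l n =
     {M. (\<forall>p\<in>#M. fst p \<ge> 2 \<and> snd p \<in> {1..l}) \<and> prod_mset (image_mset fst M) = n}"

definition distinct_parts :: "'a multiset \<Rightarrow> bool" where
  "distinct_parts M \<longleftrightarrow> (\<forall>x. count M x \<le> 1)"

definition uses_all_colors :: "nat \<Rightarrow> (nat \<times> nat) multiset \<Rightarrow> bool" where
  "uses_all_colors l M \<longleftrightarrow> (\<forall>c\<in>{1..l}. \<exists>p\<in>#M. snd p = c)"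

(* a_l(n), b_l(n), f(n), g(n). The latter two are only meant for n >= 2:
   at n = 1 they count the empty factorization. *)
definition num_colored :: "nat \<Rightarrow> nat \<Rightarrow> nat" where
  "num_colored l n =
     (if n \<ge> 2 then card {M \<in> colored_factorizations l n. uses_all_colors l M} else 0)"

definition num_distinct_colored :: "nat \<Rightarrow> nat \<Rightarrow> nat" where
  "num_distinct_colored l n =
     (if n \<ge> 2
      then card {M \<in> colored_factorizations l n. distinct_parts M \<and> uses_all_colors l M}
      else 0)"

definition num_factorizations :: "nat \<Rightarrow> nat" where
  "num_factorizations n = card (factorizations n)"

definition num_distinct_factorizations :: "nat \<Rightarrow> nat" where
  "num_distinct_factorizations n = card {M \<in> factorizations n. distinct_parts M}"

(* Arithmetic functions are functions on nat of which only the values at n >= 1 matter. *)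
definition dirichlet_conv ::
    "(nat \<Rightarrow> 'a::comm_semiring_1) \<Rightarrow> (nat \<Rightarrow> 'a) \<Rightarrow> nat \<Rightarrow> 'a" where
  "dirichlet_conv \<phi> \<psi> n = (\<Sum>(n1, n2) \<in> {(n1, n2). n1 * n2 = n}. \<phi> n1 * \<psi> n2)"

(* The 0-fold power, the convolution unit, is a convention; only l >= 1 is used. *)
fun dirichlet_power :: "(nat \<Rightarrow> 'a::comm_semiring_1) \<Rightarrow> nat \<Rightarrow> nat \<Rightarrow> 'a" where
  "dirichlet_power \<phi> 0 = (\<lambda>n. if n = 1 then 1 else 0)"
| "dirichlet_power \<phi> (Suc 0) = \<phi>"
| "dirichlet_power \<phi> (Suc (Suc l)) = dirichlet_conv (dirichlet_power \<phi> (Suc l)) \<phi>"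

definition truncate_one :: "(nat \<Rightarrow> nat) \<Rightarrow> nat \<Rightarrow> nat" where
  "truncate_one \<phi> n = (if n \<ge> 2 then \<phi> n else 0)"

end

theory Submission
  imports Defs
begin

text \<open>
  A coloured factorization of \<open>n\<close> that uses all of \<open>l\<close> colours is an \<open>l\<close>-tuple of nonempty
  uncoloured factorizations, one for each colour, whose products multiply to \<open>n\<close>; its parts are
  pairwise distinct exactly if this holds within each colour. Counting such tuples is by definition
  an \<open>l\<close>-fold Dirichlet convolution of the number of nonempty factorizations. Formally the colours
  are split off one at a time (\<open>card_full_colored_Suc\<close>), which yields both convolution identities
  (\<open>num_colored_eq_power\<close>).

  The identity for the Dirichlet series follows from the one for the coefficients. For a completely
  multiplicative \<open>x\<close>, here \<open>x n = n powr - s\<close>, the sum of \<open>f n * x n\<close> over all \<open>n\<close>, where \<open>f\<close> counts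
  uncoloured factorizations, is the sum over all finite multisets \<open>M\<close> of integers
  \<open>d \<ge> 2\<close> of the product of the \<open>x d\<close> over the entries of \<open>M\<close>. Choosing the multiplicity of each
  \<open>d\<close> independently turns this sum into the product of the geometric series \<open>1 / (1 - x d)\<close>
  (\<open>euler_product\<close>). Removing the empty multiset subtracts 1, and convolution powers become powers
  of the sum (\<open>has_sum_dirichlet_power\<close>). Every interchange of summations is justified by absolute
  convergence, which is the same statement for the real weight \<open>norm \<circ> x\<close>; for this reason the
  analytic lemmas are stated for an arbitrary complete normed field.
\<close>

section \<open>Splitting off the last colour\<close>

text \<open>
  This bound limits the number of parts of a factorization, which makes the sets of factorizations
  finite, and it shows that only the empty multiset has product 1.
\<close>

lemma two_power_size_le_prod:
  fixes v :: "'a \<Rightarrow> nat"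
  assumes "\<forall>p\<in>#M. 2 \<le> v p"
  shows "2 ^ size M \<le> prod_mset (image_mset v M)"
  using assms
proof (induction M)
  case (add p M)
  then have "2 * 2 ^ size M \<le> v p * prod_mset (image_mset v M)"
    by (intro mult_mono) auto
  then show ?case by simp
qed simp

lemma prod_ge_2:
  fixes v :: "'a \<Rightarrow> nat"
  assumes "\<forall>p\<in>#M. 2 \<le> v p" "M \<noteq> {#}"
  shows "2 \<le> prod_mset (image_mset v M)"
proof -
  have "(2::nat) ^ 1 \<le> 2 ^ size M"
    using assms(2) by (intro power_increasing) (auto simp: Suc_le_eq nonempty_has_size)
  then show ?thesis using two_power_size_le_prod[OF assms(1)] by simp
qed

lemma finite_multisets_bounded_size:
  assumes "finite A"
  shows "finite {M. set_mset M \<subseteq> A \<and> size M \<le> n}"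
proof (rule finite_subset)
  show "{M. set_mset M \<subseteq> A \<and> size M \<le> n} \<subseteq> mset ` {xs. set xs \<subseteq> A \<and> length xs \<le> n}"
  proof
    fix M assume M: "M \<in> {M. set_mset M \<subseteq> A \<and> size M \<le> n}"
    obtain xs where "mset xs = M" using ex_mset by blast
    with M show "M \<in> mset ` {xs. set xs \<subseteq> A \<and> length xs \<le> n}"
      by (auto intro!: image_eqI[of _ _ xs])
  qed
qed (use assms in \<open>simp add: finite_lists_length_le\<close>)

lemma finite_colored_factorizations:
  assumes "n \<ge> 1"
  shows "finite (colored_factorizations l n)"
proof (rule finite_subset)
  show "colored_factorizations l n \<subseteq> {M. set_mset M \<subseteq> {..n} \<times> {1..l} \<and> size M \<le> n}"
  proof clarify
    fix M assume M: "M \<in> colored_factorizations l n"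
    then have ge: "\<forall>p\<in>#M. 2 \<le> fst p" and prod: "prod_mset (image_mset fst M) = n"
      by (auto simp: colored_factorizations_def)
    have "fst p \<le> n" if "p \<in># M" for p
    proof -
      have "fst p dvd n" unfolding prod[symmetric]
        using that by (intro dvd_prod_mset) auto
      with assms show ?thesis by (intro dvd_imp_le) auto
    qed
    moreover have "size M \<le> n"
      using two_power_size_le_prod[OF ge] less_exp[of "size M"] prod by linarith
    ultimately show "set_mset M \<subseteq> {..n} \<times> {1..l} \<and> size M \<le> n"
      using M by (force simp: colored_factorizations_def)
  qed
qed (simp add: finite_multisets_bounded_size)

lemma finite_factorizations:
  assumes "n \<ge> 1"
  shows "finite (factorizations n)"
proof (rule finite_subset)
  show "factorizations n \<subseteq> image_mset fst ` colored_factorizations 1 n"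
  proof
    fix M assume "M \<in> factorizations n"
    then have "image_mset (\<lambda>d. (d, 1)) M \<in> colored_factorizations 1 n"
      by (auto simp: factorizations_def colored_factorizations_def multiset.map_comp o_def)
    then show "M \<in> image_mset fst ` colored_factorizations 1 n"
      by (intro image_eqI[of _ _ "image_mset (\<lambda>d. (d, 1)) M"])
        (auto simp: multiset.map_comp o_def)
  qed
qed (use assms finite_colored_factorizations in blast)

lemma distinct_parts_union_disjoint:
  assumes "set_mset A \<inter> set_mset B = {}"
  shows "distinct_parts (A + B) \<longleftrightarrow> distinct_parts A \<and> distinct_parts B"
proof -
  have "count A x + count B x \<le> 1 \<longleftrightarrow> count A x \<le> 1 \<and> count B x \<le> 1" for x
  proof -
    have "count A x = 0 \<or> count B x = 0"
      using assms by (auto simp: count_eq_zero_iff)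
    then show ?thesis by auto
  qed
  then show ?thesis
    unfolding distinct_parts_def count_union by blast
qed

lemma count_image_mset_inj:
  assumes "inj f"
  shows "count (image_mset f A) (f x) = count A x"
  by (induction A) (use assms in \<open>auto dest: injD\<close>)

lemma distinct_parts_image_inj:
  assumes "inj f"
  shows "distinct_parts (image_mset f B) \<longleftrightarrow> distinct_parts B"
proof
  assume "distinct_parts (image_mset f B)"
  then have "count (image_mset f B) (f x) \<le> 1" for x
    by (simp add: distinct_parts_def)
  then show "distinct_parts B"
    unfolding distinct_parts_def count_image_mset_inj[OF assms] by blast
next
  assume B: "distinct_parts B"
  show "distinct_parts (image_mset f B)"
    unfolding distinct_parts_def
  proof
    fix y
    show "count (image_mset f B) y \<le> 1"
    proof (cases "y \<in># image_mset f B")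
      case True
      then obtain x where "y = f x" by auto
      with B show ?thesis by (simp add: distinct_parts_def count_image_mset_inj[OF assms])
    next
      case False
      then have "count (image_mset f B) y = 0" by (rule not_in_iff[THEN iffD1])
      then show ?thesis by simp
    qed
  qed
qed

text \<open>
  The Boolean selects between the two counting problems, so that a single bijection handles both.
\<close>

definition full_colored :: "bool \<Rightarrow> nat \<Rightarrow> nat \<Rightarrow> (nat \<times> nat) multiset set" where
  "full_colored D l n =
     {M \<in> colored_factorizations l n. (D \<longrightarrow> distinct_parts M) \<and> uses_all_colors l M}"

definition uncolored :: "bool \<Rightarrow> nat \<Rightarrow> nat multiset set" where
  "uncolored D n = {M \<in> factorizations n. D \<longrightarrow> distinct_parts M}"

lemma finite_divisor_pairs:
  assumes "n \<ge> 1"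
  shows "finite {(n1, n2). n1 * n2 = (n::nat)}"
  by (rule finite_subset[of _ "{..n} \<times> {..n}"])
    (use assms in \<open>auto intro: dvd_imp_le simp: Suc_le_eq\<close>)

lemma full_colored_0: "n \<ge> 1 \<Longrightarrow> card (full_colored D 0 n) = (if n = 1 then 1 else 0)"
proof -
  have "full_colored D 0 n = (if n = 1 then {{#}} else {})"
  proof -
    have "M = {#}" if "M \<in> full_colored D 0 n" for M
    proof -
      have "snd p \<in> {1..0}" if "p \<in># M" for p
        using that \<open>M \<in> full_colored D 0 n\<close>
        unfolding full_colored_def colored_factorizations_def by blast
      then show ?thesis by (metis atLeastatMost_empty empty_iff multiset_nonemptyE zero_less_one)
    qed
    moreover have "{#} \<in> full_colored D 0 n \<longleftrightarrow> n = 1"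
      by (auto simp: full_colored_def colored_factorizations_def uses_all_colors_def
          distinct_parts_def)
    ultimately show ?thesis by auto
  qed
  then show ?thesis by simp
qed

text \<open>
  A factorization in the colours up to \<open>l + 1\<close> is the same as a factorization in the colours up
  to \<open>l\<close> together with the uncoloured multiset of the values that carry the last colour. All
  colours are used on the left exactly if all of the first \<open>l\<close> are used in the first component
  and the second component is nonempty, that is, if its product is at least 2: this is why the
  value at 1 has to be truncated.
\<close>

lemma card_full_colored_Suc:
  assumes n: "n \<ge> 1"
  shows "card (full_colored D (Suc l) n) =
    dirichlet_conv (\<lambda>m. card (full_colored D l m))
      (truncate_one (\<lambda>m. card (uncolored D m))) n"
proof -
  define I where "I = {(n1, n2). n1 * n2 = n}"
  define T where "T = (\<lambda>m. if m \<ge> 2 then uncolored D m else {})"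
  define X where "X = Sigma I (\<lambda>(n1, n2). full_colored D l n1 \<times> T n2)"
  define paint :: "nat multiset \<Rightarrow> (nat \<times> nat) multiset"
    where "paint = image_mset (\<lambda>d. (d, Suc l))"
  define low high :: "(nat \<times> nat) multiset \<Rightarrow> (nat \<times> nat) multiset"
    where "low = filter_mset (\<lambda>p. snd p \<le> l)" and "high = filter_mset (\<lambda>p. \<not> snd p \<le> l)"
  define split where "split M = ((prod_mset (image_mset fst (low M)),
      prod_mset (image_mset fst (high M))), low M, image_mset fst (high M))" for M
  define join where "join = (\<lambda>(_ :: nat \<times> nat, A, B). A + paint B)"

  have I: "finite I" "\<And>n1 n2. (n1, n2) \<in> I \<Longrightarrow> n1 \<ge> 1 \<and> n2 \<ge> 1"
    using finite_divisor_pairs[OF n] n by (auto simp: I_def Suc_le_eq)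
  have fst_paint [simp]: "image_mset fst (paint B) = B" for B
    by (simp add: paint_def multiset.map_comp o_def)
  have low_paint [simp]: "low (paint B) = {#}" "high (paint B) = paint B" for B
    by (auto simp: low_def high_def paint_def filter_mset_image_mset)
  have low_high [simp]: "low M + high M = M" for M
    by (simp add: low_def high_def multiset_partition[symmetric])
  have distinct: "distinct_parts (A + paint B) \<longleftrightarrow> distinct_parts A \<and> distinct_parts B"
    if "\<forall>p\<in>#A. snd p \<le> l" for A B
  proof -
    have "set_mset A \<inter> set_mset (paint B) = {}"
      using that by (force simp: paint_def)
    then show ?thesis
      by (simp add: distinct_parts_union_disjoint paint_def distinct_parts_image_inj inj_on_def)
  qed
  have in_X: "((n1, n2), A, B) \<in> X \<longleftrightarrow> n1 * n2 = n \<and> A \<in> full_colored D l n1 \<and> B \<in> T n2"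
    for n1 n2 A B by (auto simp: X_def I_def)

  have join_in: "A + paint B \<in> full_colored D (Suc l) n"
    and low_A: "low A = A" and high_A: "high A = {#}"
    and prods: "prod_mset (image_mset fst A) = n1" "prod_mset B = n2"
    if "((n1, n2), A, B) \<in> X" for n1 n2 A B
  proof -
    have A: "\<forall>p\<in>#A. fst p \<ge> 2 \<and> snd p \<in> {1..l}" "prod_mset (image_mset fst A) = n1"
        "D \<longrightarrow> distinct_parts A" "uses_all_colors l A"
      using that by (auto simp: in_X full_colored_def colored_factorizations_def)
    have B: "\<forall>d\<in>#B. d \<ge> 2" "prod_mset B = n2" "D \<longrightarrow> distinct_parts B" "n2 \<ge> 2"
      using that by (auto simp: in_X T_def uncolored_def factorizations_def split: if_splits)
    have le: "snd p \<le> l" if "p \<in># A" for p using A(1) that by auto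
    have "low A = filter_mset (\<lambda>_. True) A"
      unfolding low_def by (rule filter_mset_cong) (use le in auto)
    then show "low A = A" by simp
    have "high A = filter_mset (\<lambda>_. False) A"
      unfolding high_def by (rule filter_mset_cong) (use le in auto)
    then show "high A = {#}" by simp
    show "prod_mset (image_mset fst A) = n1" "prod_mset B = n2" by fact+
    have "B \<noteq> {#}" using B by auto
    then obtain d where "d \<in># B" by blast
    then have "(d, Suc l) \<in># A + paint B" by (auto simp: paint_def)
    moreover have "\<exists>p\<in>#A + paint B. snd p = c" if "c \<in> {1..l}" for c
      using A(4) that by (auto simp: uses_all_colors_def)
    ultimately have "uses_all_colors (Suc l) (A + paint B)"
      unfolding uses_all_colors_def by (metis atLeastAtMost_iff le_Suc_eq snd_conv)
    moreover have "\<forall>p\<in>#A + paint B. fst p \<ge> 2 \<and> snd p \<in> {1..Suc l}"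
      using A(1) B(1) by (auto simp: paint_def)
    moreover have "prod_mset (image_mset fst (A + paint B)) = n"
      using A(2) B(2) that by (simp add: in_X)
    moreover have "D \<longrightarrow> distinct_parts (A + paint B)"
      using A(1,3) B(3) by (subst distinct) auto
    ultimately show "A + paint B \<in> full_colored D (Suc l) n"
      unfolding full_colored_def colored_factorizations_def by blast
  qed

  have split_in: "split M \<in> X" and paint_high: "paint (image_mset fst (high M)) = high M"
    if "M \<in> full_colored D (Suc l) n" for M
  proof -
    have M: "\<forall>p\<in>#M. fst p \<ge> 2 \<and> snd p \<in> {1..Suc l}" "prod_mset (image_mset fst M) = n"
        "D \<longrightarrow> distinct_parts M" "uses_all_colors (Suc l) M"
      using that by (auto simp: full_colored_def colored_factorizations_def)
    have "(fst p, Suc l) = p" if "p \<in># high M" for p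
      using that M(1) by (cases p) (force simp: high_def)
    then have "image_mset (\<lambda>p. (fst p, Suc l)) (high M) = image_mset id (high M)"
      by (intro image_mset_cong) auto
    then show ph: "paint (image_mset fst (high M)) = high M"
      by (simp add: paint_def multiset.map_comp o_def)
    let ?B = "image_mset fst (high M)"
    have dM: "D \<longrightarrow> distinct_parts (low M) \<and> distinct_parts ?B"
      using M(3) distinct[of "low M" ?B] by (simp add: ph) (simp add: low_def)
    have "prod_mset (image_mset fst (low M + high M)) = n"
      using M(2) by simp
    then have nn: "prod_mset (image_mset fst (low M)) * prod_mset ?B = n"
      by (simp only: image_mset_union prod_mset.union)
    have "\<exists>p\<in>#M. snd p = Suc l" using M(4) by (auto simp: uses_all_colors_def)
    then obtain p where "p \<in># M" "snd p = Suc l" by blast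
    then have "p \<in># high M" by (simp add: high_def)
    then have "high M \<noteq> {#}" by auto
    moreover have ge: "\<forall>p\<in>#high M. 2 \<le> fst p" using M(1) by (auto simp: high_def)
    ultimately have "prod_mset ?B \<ge> 2" by (intro prod_ge_2) auto
    then have "?B \<in> T (prod_mset ?B)"
      using ge dM by (auto simp: T_def uncolored_def factorizations_def)
    moreover have "uses_all_colors l (low M)"
      unfolding uses_all_colors_def
    proof
      fix c assume c: "c \<in> {1..l}"
      then have "\<exists>p\<in>#M. snd p = c" using M(4) by (simp add: uses_all_colors_def)
      then obtain p where "p \<in># M" "snd p = c" by blast
      with c have "p \<in># low M" by (simp add: low_def)
      with \<open>snd p = c\<close> show "\<exists>p\<in>#low M. snd p = c" by blast
    qed
    then have "low M \<in> full_colored D l (prod_mset (image_mset fst (low M)))"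
      using M(1) dM by (auto simp: full_colored_def colored_factorizations_def low_def)
    ultimately show "split M \<in> X" using nn by (simp add: split_def in_X)
  qed

  have "bij_betw join X (full_colored D (Suc l) n)"
  proof (rule bij_betw_byWitness[where f' = split])
    show "\<forall>x\<in>X. split (join x) = x"
    proof
      fix x assume x: "x \<in> X"
      obtain n1 n2 A B where [simp]: "x = ((n1, n2), A, B)"
        by (metis prod.exhaust)
      have [simp]: "low A = A" "high A = {#}" "prod_mset (image_mset fst A) = n1" "prod_mset B = n2"
        using low_A high_A prods x by auto
      have "low (A + paint B) = low A + low (paint B)" "high (A + paint B) = high A + high (paint B)"
        by (simp_all only: low_def high_def filter_union_mset)
      then show "split (join x) = x" by (simp add: split_def join_def)
    qed
    show "\<forall>M\<in>full_colored D (Suc l) n. join (split M) = M"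
      using paint_high by (simp add: split_def join_def)
    show "join ` X \<subseteq> full_colored D (Suc l) n"
      using join_in by (auto simp: join_def)
    show "split ` full_colored D (Suc l) n \<subseteq> X"
      using split_in by auto
  qed
  then have "card (full_colored D (Suc l) n) = card X"
    by (rule bij_betw_same_card[symmetric])
  also have "\<dots> = (\<Sum>(n1, n2)\<in>I. card (full_colored D l n1) * card (T n2))"
  proof -
    have "finite (full_colored D l n1 \<times> T n2)" if "(n1, n2) \<in> I" for n1 n2
      using I(2)[OF that] finite_colored_factorizations[of n1 l] finite_factorizations[of n2]
      by (auto simp: full_colored_def uncolored_def T_def)
    then show ?thesis
      unfolding X_def using I(1)
      by (subst card_SigmaI) (auto intro!: sum.cong simp: card_cartesian_product)
  qed
  also have "\<dots> = dirichlet_conv (\<lambda>m. card (full_colored D l m))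
      (truncate_one (\<lambda>m. card (uncolored D m))) n"
    unfolding dirichlet_conv_def I_def by (intro sum.cong) (auto simp: T_def truncate_one_def)
  finally show ?thesis .
qed

lemma dirichlet_conv_cong:
  assumes "n \<ge> 1" "\<And>m. m \<ge> 1 \<Longrightarrow> \<phi> m = \<phi>' m" "\<And>m. m \<ge> 1 \<Longrightarrow> \<psi> m = \<psi>' m"
  shows "dirichlet_conv \<phi> \<psi> n = dirichlet_conv \<phi>' \<psi>' n"
  unfolding dirichlet_conv_def
proof (intro sum.cong refl, clarify)
  fix n1 n2 assume "n = n1 * n2"
  with assms(1) have "n1 \<ge> 1" "n2 \<ge> 1" by (simp_all add: Suc_le_eq)
  then show "\<phi> n1 * \<psi> n2 = \<phi>' n1 * \<psi>' n2" by (simp only: assms(2,3))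
qed

text \<open>The convolution unit lets all inductions on the exponent start at 0.\<close>

lemma dirichlet_power_Suc_conv:
  assumes "n \<ge> 1"
  shows "dirichlet_power \<phi> (Suc l) n = dirichlet_conv (dirichlet_power \<phi> l) \<phi> n"
proof (cases l)
  case 0
  have "dirichlet_conv (dirichlet_power \<phi> 0) \<phi> n = (\<Sum>p\<in>{(1::nat, n)}. \<phi> n)"
    unfolding dirichlet_conv_def
  proof (rule sum.mono_neutral_cong_right[OF finite_divisor_pairs[OF assms]])
    show "\<forall>p\<in>{(n1, n2). n1 * n2 = n} - {(1, n)}.
        (case p of (n1, n2) \<Rightarrow> dirichlet_power \<phi> 0 n1 * \<phi> n2) = 0"
    proof
      fix p assume "p \<in> {(n1, n2). n1 * n2 = n} - {(1, n)}"
      then obtain n1 n2 where p: "p = (n1, n2)" "n1 * n2 = n" "(n1, n2) \<noteq> (1, n)"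
        by (cases p) auto
      then have "n1 \<noteq> 1" by (intro notI) simp
      then show "(case p of (n1, n2) \<Rightarrow> dirichlet_power \<phi> 0 n1 * \<phi> n2) = 0"
        by (simp add: p(1))
    qed
  qed simp_all
  with 0 show ?thesis by simp
qed simp

lemma card_full_colored_eq_power:
  assumes "n \<ge> 1"
  shows "card (full_colored D l n) =
    dirichlet_power (truncate_one (\<lambda>m. card (uncolored D m))) l n"
  using assms
proof (induction l arbitrary: n)
  case 0
  then show ?case by (simp add: full_colored_0)
next
  case (Suc l)
  have "card (full_colored D (Suc l) n) =
      dirichlet_conv (\<lambda>m. card (full_colored D l m))
      (truncate_one (\<lambda>m. card (uncolored D m))) n"
    by (rule card_full_colored_Suc[OF Suc.prems])
  also have "\<dots> = dirichlet_power (truncate_one (\<lambda>m. card (uncolored D m))) (Suc l) n"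
    unfolding dirichlet_power_Suc_conv[OF Suc.prems]
    by (intro dirichlet_conv_cong Suc) auto
  finally show ?case .
qed

lemma full_colored_1:
  assumes "l \<ge> 1"
  shows "full_colored D l 1 = {}"
proof -
  have False if "M \<in> full_colored D l 1" for M
  proof -
    have "M \<noteq> {#}" using that assms by (force simp: full_colored_def uses_all_colors_def)
    then show False
      using that prod_ge_2[of M fst] by (auto simp: full_colored_def colored_factorizations_def)
  qed
  then show ?thesis by blast
qed

lemma num_colored_eq_power:
  assumes "l \<ge> 1" "n \<ge> 1"
  shows "num_colored l n = dirichlet_power (truncate_one num_factorizations) l n"
    and "num_distinct_colored l n =
      dirichlet_power (truncate_one num_distinct_factorizations) l n"
proof -
  have "num_colored l n = card (full_colored False l n)"
      "num_distinct_colored l n = card (full_colored True l n)"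
  proof -
    show "num_colored l n = card (full_colored False l n)"
    proof (cases "n = 1")
      case True
      then show ?thesis
        unfolding True full_colored_1[OF assms(1)] by (simp add: num_colored_def)
    next
      case False
      with assms(2) show ?thesis by (simp add: num_colored_def full_colored_def)
    qed
    show "num_distinct_colored l n = card (full_colored True l n)"
    proof (cases "n = 1")
      case True
      then show ?thesis
        unfolding True full_colored_1[OF assms(1)] by (simp add: num_distinct_colored_def)
    next
      case False
      with assms(2) show ?thesis by (simp add: num_distinct_colored_def full_colored_def)
    qed
  qed
  moreover have "(\<lambda>m. card (uncolored False m)) = num_factorizations"
      "(\<lambda>m. card (uncolored True m)) = num_distinct_factorizations"
    by (simp_all add: fun_eq_iff uncolored_def num_factorizations_def
        num_distinct_factorizations_def)
  ultimately show "num_colored l n = dirichlet_power (truncate_one num_factorizations) l n"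
      "num_distinct_colored l n =
        dirichlet_power (truncate_one num_distinct_factorizations) l n"
    by (simp_all only: card_full_colored_eq_power[OF assms(2)])
qed

section \<open>The Euler product over multisets\<close>

lemma has_sum_product:
  fixes f :: "'a \<Rightarrow> 'c::{real_normed_field,banach}" and g :: "'b \<Rightarrow> 'c"
  assumes f: "f abs_summable_on A" "(f has_sum a) A"
    and g: "g abs_summable_on B" "(g has_sum b) B"
  shows "(\<lambda>(u, v). f u * g v) abs_summable_on A \<times> B"
    and "((\<lambda>(u, v). f u * g v) has_sum a * b) (A \<times> B)"
proof -
  show abs: "(\<lambda>(u, v). f u * g v) abs_summable_on A \<times> B"
  proof (rule summable_on_SigmaI)
    show "((\<lambda>v. norm (case (u, v) of (u, v) \<Rightarrow> f u * g v)) has_sum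
        norm (f u) * infsum (\<lambda>v. norm (g v)) B) B" for u
      using has_sum_cmult_right[OF has_sum_infsum[OF g(1)]] by (simp add: norm_mult)
    show "(\<lambda>u. norm (f u) * infsum (\<lambda>v. norm (g v)) B) summable_on A"
      by (rule summable_on_cmult_left[OF f(1)])
  qed auto
  show "((\<lambda>(u, v). f u * g v) has_sum a * b) (A \<times> B)"
  proof (rule has_sum_SigmaI)
    show "((\<lambda>v. case (u, v) of (u, v) \<Rightarrow> f u * g v) has_sum f u * b) B" for u
      using has_sum_cmult_right[OF g(2)] by simp
    show "((\<lambda>u. f u * b) has_sum a * b) A"
      by (rule has_sum_cmult_left[OF f(2)])
    show "(\<lambda>(u, v). f u * g v) summable_on A \<times> B"
      by (rule abs_summable_summable[OF abs])
  qed
qed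

lemma has_sum_geometric:
  fixes c :: "'a::{real_normed_field,banach}"
  assumes "norm c < 1"
  shows "(\<lambda>k. c ^ k) abs_summable_on UNIV" "((\<lambda>k. c ^ k) has_sum inverse (1 - c)) UNIV"
proof -
  have "summable (\<lambda>k. norm (c ^ k))"
    using assms by (simp add: norm_power summable_geometric)
  then show "(\<lambda>k. c ^ k) abs_summable_on UNIV" "((\<lambda>k. c ^ k) has_sum inverse (1 - c)) UNIV"
    using norm_summable_imp_has_sum[OF _ geometric_sums[OF assms]]
      summable_on_UNIV_nonneg_real_iff[of "\<lambda>k. norm (c ^ k)"]
    by (simp_all add: inverse_eq_divide)
qed

text \<open>
  The multiplicity of a new element \<open>d\<close> can be chosen independently of the rest of the multiset,
  so allowing \<open>d\<close> multiplies the sum by the geometric series of \<open>x d\<close>. Absolute summability is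
  carried along because the product of two sums requires it.
\<close>

lemma euler_product_finite:
  fixes x :: "'b \<Rightarrow> 'a::{real_normed_field,banach}"
  assumes "finite D" "\<And>d. d \<in> D \<Longrightarrow> norm (x d) < 1"
  shows "(\<lambda>M. prod_mset (image_mset x M)) abs_summable_on {M. set_mset M \<subseteq> D} \<and>
    ((\<lambda>M. prod_mset (image_mset x M)) has_sum (\<Prod>d\<in>D. inverse (1 - x d))) {M. set_mset M \<subseteq> D}"
  using assms
proof (induction D)
  case empty
  have "{M :: 'b multiset. set_mset M \<subseteq> {}} = {{#}}" by auto
  then show ?case by (simp add: has_sum_finiteI)
next
  case (insert d D)
  define w where "w M = prod_mset (image_mset x M)" for M
  define add_copies where "add_copies = (\<lambda>(k, M). M + replicate_mset k d)"
  have bij: "bij_betw add_copies (UNIV \<times> {M. set_mset M \<subseteq> D}) {M. set_mset M \<subseteq> insert d D}"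
  proof (rule bij_betw_byWitness[where f' = "\<lambda>M. (count M d, filter_mset (\<lambda>e. e \<noteq> d) M)"])
    show "\<forall>p\<in>UNIV \<times> {M. set_mset M \<subseteq> D}.
        (count (add_copies p) d, filter_mset (\<lambda>e. e \<noteq> d) (add_copies p)) = p"
    proof
      fix p :: "nat \<times> 'b multiset" assume "p \<in> UNIV \<times> {M. set_mset M \<subseteq> D}"
      then obtain k M where p: "p = (k, M)" and M: "set_mset M \<subseteq> D" by auto
      with insert.hyps have "d \<notin># M" by auto
      then have "filter_mset (\<lambda>e. e \<noteq> d) M = filter_mset (\<lambda>_. True) M"
        by (intro filter_mset_cong) auto
      moreover have "count M d = 0" using \<open>d \<notin># M\<close> by (simp add: not_in_iff)
      ultimately show "(count (add_copies p) d, filter_mset (\<lambda>e. e \<noteq> d) (add_copies p)) = p"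
        by (simp add: p add_copies_def)
    qed
    show "\<forall>M\<in>{M. set_mset M \<subseteq> insert d D}.
        add_copies (count M d, filter_mset (\<lambda>e. e \<noteq> d) M) = M"
      by (auto simp: add_copies_def multiset_eq_iff)
    show "add_copies ` (UNIV \<times> {M. set_mset M \<subseteq> D}) \<subseteq> {M. set_mset M \<subseteq> insert d D}"
      by (auto simp: add_copies_def split: if_splits)
    show "(\<lambda>M. (count M d, filter_mset (\<lambda>e. e \<noteq> d) M)) ` {M. set_mset M \<subseteq> insert d D}
        \<subseteq> UNIV \<times> {M. set_mset M \<subseteq> D}"
      by auto
  qed
  have w_add: "w (add_copies p) = (case p of (k, M) \<Rightarrow> x d ^ k * w M)" for p
    by (cases p) (simp add: add_copies_def w_def)
  have "w abs_summable_on {M. set_mset M \<subseteq> D}"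
      "(w has_sum (\<Prod>e\<in>D. inverse (1 - x e))) {M. set_mset M \<subseteq> D}"
    using insert unfolding w_def by auto
  note prod = has_sum_product[OF has_sum_geometric this]
  have "norm (x d) < 1" using insert.prems by simp
  then have "(\<lambda>p. w (add_copies p)) abs_summable_on UNIV \<times> {M. set_mset M \<subseteq> D}"
      "((\<lambda>p. w (add_copies p)) has_sum inverse (1 - x d) * (\<Prod>e\<in>D. inverse (1 - x e)))
        (UNIV \<times> {M. set_mset M \<subseteq> D})"
    using prod[of "x d"] by (simp_all only: w_add)
  then have "w abs_summable_on {M. set_mset M \<subseteq> insert d D}"
      "(w has_sum inverse (1 - x d) * (\<Prod>e\<in>D. inverse (1 - x e))) {M. set_mset M \<subseteq> insert d D}"
    using summable_on_reindex_bij_betw[OF bij, of "\<lambda>M. norm (w M)"]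
      has_sum_reindex_bij_betw[OF bij, of w] by auto
  then show ?case using insert.hyps by (simp add: w_def[abs_def])
qed

text \<open>
  What is missing from \<open>B n\<close> is eventually contained in the complement of a finite set that already
  carries almost all of the absolute mass.
\<close>

lemma infsum_exhaustion:
  fixes f :: "'a \<Rightarrow> 'b::banach"
  assumes abs: "f abs_summable_on A" and sub: "\<And>n. B n \<subseteq> A"
    and ev: "\<And>F. finite F \<Longrightarrow> F \<subseteq> A \<Longrightarrow> \<forall>\<^sub>F n in sequentially. F \<subseteq> B n"
  shows "(\<lambda>n. infsum f (B n)) \<longlonglongrightarrow> infsum f A"
proof (rule tendstoI)
  fix e :: real assume "e > 0"
  then obtain F where F: "finite F" "F \<subseteq> A"
      "dist (sum (\<lambda>x. norm (f x)) F) (infsum (\<lambda>x. norm (f x)) A) \<le> e / 2"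
    using infsum_finite_approximation[OF abs, of "e / 2"] by auto
  have fA: "f summable_on A" by (rule abs_summable_summable[OF abs])
  show "\<forall>\<^sub>F n in sequentially. dist (infsum f (B n)) (infsum f A) < e"
    using ev[OF F(1,2)]
  proof eventually_elim
    case (elim n)
    have "infsum f A - infsum f (B n) = infsum f (A - B n)"
      using fA summable_on_subset_banach[OF fA sub] sub by (intro infsum_Diff[symmetric]) auto
    also have "norm \<dots> \<le> infsum (\<lambda>x. norm (f x)) (A - B n)"
      by (intro norm_infsum_bound summable_on_subset_banach[OF abs]) auto
    also have "\<dots> \<le> infsum (\<lambda>x. norm (f x)) (A - F)"
      using elim by (intro infsum_mono2 summable_on_subset_banach[OF abs]) auto
    also have "\<dots> = infsum (\<lambda>x. norm (f x)) A - sum (\<lambda>x. norm (f x)) F"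
      using F abs by (subst infsum_Diff) auto
    also have "\<dots> \<le> e / 2"
      using F(3) unfolding dist_real_def by linarith
    finally show ?case using \<open>e > 0\<close> by (simp add: dist_norm norm_minus_commute)
  qed
qed

lemma convergent_prod_euler:
  fixes x :: "nat \<Rightarrow> 'a::{real_normed_field,banach}"
  assumes "summable (\<lambda>k. norm (x k))"
  shows "convergent_prod (\<lambda>k. inverse (1 - x k))"
proof -
  have "abs_convergent_prod (\<lambda>k. 1 - x k)"
    using assms by (simp add: abs_convergent_prod_conv_summable)
  then show ?thesis
    by (intro convergent_prod_inverse abs_convergent_prod_imp_convergent_prod)
qed

lemma prod_shift_two: "(\<Prod>d\<in>{2..n+2}. h d) = (\<Prod>k\<le>n. h (k + 2 :: nat))"
  by (rule prod.reindex_bij_witness[of _ "\<lambda>k. k + 2" "\<lambda>d. d - 2"])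
    (auto simp del: add_2_eq_Suc add_2_eq_Suc')

lemma finite_multisets_eventually_bounded:
  assumes "finite F" "F \<subseteq> {M. set_mset M \<subseteq> {2..}}"
  shows "\<forall>\<^sub>F n in sequentially. F \<subseteq> {M. set_mset M \<subseteq> {2..n+2::nat}}"
proof -
  have "finite (\<Union>M\<in>F. set_mset M)" using assms(1) by auto
  then obtain m where "\<forall>d\<in>(\<Union>M\<in>F. set_mset M). d \<le> m"
    unfolding finite_nat_set_iff_bounded_le by blast
  then have "F \<subseteq> {M. set_mset M \<subseteq> {2..n+2}}" if "n \<ge> m" for n
    using that assms(2) by fastforce
  then show ?thesis unfolding eventually_sequentially by blast
qed

text \<open>
  Any finite set of multisets lies in the range of a finite partial product. For the weight
  \<open>norm \<circ> x\<close> the partial products are bounded, which gives absolute summability over all multisets;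
  the sum is then the limit of the partial products for \<open>x\<close>.
\<close>

lemma euler_product:
  fixes x :: "nat \<Rightarrow> 'a::{real_normed_field,banach}"
  assumes x: "\<And>d. d \<ge> 2 \<Longrightarrow> norm (x d) < 1" and sm: "summable (\<lambda>k. norm (x (k + 2)))"
  shows "((\<lambda>M. prod_mset (image_mset x M)) has_sum (\<Prod>k. inverse (1 - x (k + 2))))
    {M. set_mset M \<subseteq> {2..}}"
proof -
  define w where "w M = prod_mset (image_mset x M)" for M
  define S :: "nat multiset set" where "S = {M. set_mset M \<subseteq> {2..}}"
  define B :: "nat \<Rightarrow> nat multiset set" where "B n = {M. set_mset M \<subseteq> {2..n+2}}" for n
  have ev: "\<forall>\<^sub>F n in sequentially. F \<subseteq> B n" if "finite F" "F \<subseteq> S" for F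
    using finite_multisets_eventually_bounded that unfolding B_def S_def by blast
  have B: "B n \<subseteq> S" for n unfolding B_def S_def by fastforce
  have norm_w: "norm (w M) = prod_mset (image_mset (\<lambda>d. norm (x d)) M)" for M
    by (induction M) (simp_all add: w_def norm_mult)

  have "convergent_prod (\<lambda>k. inverse (1 - norm (x (k + 2))))"
    using sm by (intro convergent_prod_euler) simp
  then have "Bseq (\<lambda>n. \<Prod>k\<le>n. inverse (1 - norm (x (k + 2))))"
    using convergent_prod_LIMSEQ convergentI convergent_imp_Bseq by blast
  then obtain K where K: "norm (\<Prod>k\<le>n. inverse (1 - norm (x (k + 2)))) \<le> K" for n
    unfolding Bseq_def by blast
  have "sum (\<lambda>M. norm (w M)) F \<le> K" if F: "finite F" "F \<subseteq> S" for F
  proof -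
    obtain n where n: "F \<subseteq> B n"
      using ev[OF F] eventually_happens by fastforce
    have "((\<lambda>M. norm (w M)) has_sum (\<Prod>d\<in>{2..n+2}. inverse (1 - norm (x d)))) (B n)"
      unfolding norm_w B_def
      using euler_product_finite[of "{2..n+2}" "\<lambda>d. norm (x d)"] x by simp
    then have "sum (\<lambda>M. norm (w M)) F \<le> (\<Prod>d\<in>{2..n+2}. inverse (1 - norm (x d)))"
      by (rule finite_sum_le_has_sum[OF _ F(1) n]) simp
    then show ?thesis using K[of n] unfolding prod_shift_two by simp
  qed
  then have abs: "w abs_summable_on S"
    by (intro nonneg_bdd_above_summable_on) (auto intro!: bdd_aboveI[where M = K])

  have "(\<lambda>n. infsum w (B n)) \<longlonglongrightarrow> infsum w S"
    by (rule infsum_exhaustion[OF abs B ev])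
  moreover have "infsum w (B n) = (\<Prod>k\<le>n. inverse (1 - x (k + 2)))" for n
  proof -
    have "(w has_sum (\<Prod>d\<in>{2..n+2}. inverse (1 - x d))) (B n)"
      unfolding w_def B_def using euler_product_finite[of "{2..n+2}" x] x by simp
    then show ?thesis unfolding prod_shift_two by (rule infsumI)
  qed
  moreover have "(\<lambda>n. \<Prod>k\<le>n. inverse (1 - x (k + 2))) \<longlonglongrightarrow> (\<Prod>k. inverse (1 - x (k + 2)))"
    by (intro convergent_prod_LIMSEQ convergent_prod_euler sm)
  ultimately have "infsum w S = (\<Prod>k. inverse (1 - x (k + 2)))"
    using LIMSEQ_unique by auto
  then show ?thesis
    using has_sum_infsum[OF abs_summable_summable[OF abs]] by (simp add: w_def[abs_def] S_def)
qed

section \<open>Dirichlet series\<close>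

text \<open>
  The product of the two sums is a sum over pairs; collecting the pairs with the same product
  \<open>n\<close>, on which the weight \<open>x n1 * x n2\<close> is constant, produces the convolution.
\<close>

lemma has_sum_conv:
  fixes x :: "nat \<Rightarrow> 'a::{real_normed_field,banach}"
  assumes mult: "\<And>m n. x (m * n) = x m * x n"
    and \<phi>: "(\<lambda>n. of_nat (\<phi> n) * x n) abs_summable_on {1..}"
      "((\<lambda>n. of_nat (\<phi> n) * x n) has_sum a) {1..}"
    and \<psi>: "(\<lambda>n. of_nat (\<psi> n) * x n) abs_summable_on {1..}"
      "((\<lambda>n. of_nat (\<psi> n) * x n) has_sum b) {1..}"
  shows "((\<lambda>n. of_nat (dirichlet_conv \<phi> \<psi> n) * x n) has_sum a * b) {1..}"
proof -
  define I where "I n = {(n1, n2). n1 * n2 = (n::nat)}" for n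
  define f where "f = (\<lambda>(n1, n2). (of_nat (\<phi> n1) * x n1) * (of_nat (\<psi> n2) * x n2))"
  have bij: "bij_betw snd (Sigma {1..} I) ({1..} \<times> {1..})"
    by (rule bij_betw_byWitness[where f' = "\<lambda>(n1, n2). (n1 * n2, (n1, n2))"])
      (auto simp: I_def Suc_le_eq)
  have "(f has_sum a * b) ({1..} \<times> {1..})"
    unfolding f_def by (rule has_sum_product(2)[OF \<phi> \<psi>])
  then have "((\<lambda>p. f (snd p)) has_sum a * b) (Sigma {1..} I)"
    using has_sum_reindex_bij_betw[OF bij, of f] by simp
  then show ?thesis
  proof (rule has_sum_SigmaD)
    fix n :: nat assume "n \<in> {1..}"
    then have "finite (I n)" using finite_divisor_pairs by (simp add: I_def)
    moreover have "of_nat (dirichlet_conv \<phi> \<psi> n) * x n = sum f (I n)"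
      unfolding dirichlet_conv_def I_def[symmetric] of_nat_sum sum_distrib_right
      by (intro sum.cong) (auto simp: f_def I_def mult)
    ultimately show "((\<lambda>p. f (snd (n, p))) has_sum of_nat (dirichlet_conv \<phi> \<psi> n) * x n) (I n)"
      by (simp add: has_sum_finiteI)
  qed
qed

lemma abs_summable_weighted_iff:
  fixes x :: "nat \<Rightarrow> 'a::{real_normed_field,banach}"
  shows "(\<lambda>n. of_nat (\<phi> n) * x n) abs_summable_on A \<longleftrightarrow>
    (\<lambda>n. of_nat (\<phi> n) * norm (x n)) summable_on A"
  by (simp add: norm_mult)

text \<open>Since the coefficients are natural numbers, this is \<open>has_sum_conv\<close> for \<open>norm \<circ> x\<close>.\<close>

lemma abs_summable_conv:
  fixes x :: "nat \<Rightarrow> 'a::{real_normed_field,banach}"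
  assumes mult: "\<And>m n. x (m * n) = x m * x n"
    and \<phi>: "(\<lambda>n. of_nat (\<phi> n) * x n) abs_summable_on {1..}"
    and \<psi>: "(\<lambda>n. of_nat (\<psi> n) * x n) abs_summable_on {1..}"
  shows "(\<lambda>n. of_nat (dirichlet_conv \<phi> \<psi> n) * x n) abs_summable_on {1..}"
proof -
  have abs: "(\<lambda>n. norm (of_nat (\<theta> n) * norm (x n))) summable_on {1..}"
      "(\<lambda>n. of_nat (\<theta> n) * norm (x n)) summable_on {1..}"
    if "(\<lambda>n. of_nat (\<theta> n) * x n) abs_summable_on {1..}" for \<theta>
    using that by (simp_all add: norm_mult abs_mult)
  show ?thesis
    unfolding abs_summable_weighted_iff
    using has_sum_conv[of "\<lambda>n. norm (x n)", OF _ abs(1)[OF \<phi>] has_sum_infsum[OF abs(2)[OF \<phi>]]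
        abs(1)[OF \<psi>] has_sum_infsum[OF abs(2)[OF \<psi>]]]
    by (auto simp: mult norm_mult dest: has_sum_imp_summable)
qed

lemma has_sum_dirichlet_power:
  fixes x :: "nat \<Rightarrow> 'a::{real_normed_field,banach}"
  assumes one: "x 1 = 1" and mult: "\<And>m n. x (m * n) = x m * x n"
    and \<phi>: "(\<lambda>n. of_nat (\<phi> n) * x n) abs_summable_on {1..}"
      "((\<lambda>n. of_nat (\<phi> n) * x n) has_sum a) {1..}"
  shows "(\<lambda>n. of_nat (dirichlet_power \<phi> l n) * x n) abs_summable_on {1..} \<and>
    ((\<lambda>n. of_nat (dirichlet_power \<phi> l n) * x n) has_sum a ^ l) {1..}"
proof (induction l)
  case 0
  have "((\<lambda>n. of_nat (dirichlet_power \<phi> 0 n) * x n) has_sum 1) {1..}"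
    by (rule has_sum_finite_neutralI[of "{1}"]) (auto simp: one[simplified])
  moreover have "(\<lambda>n. norm (of_nat (dirichlet_power \<phi> 0 n) * x n)) summable_on {1..}"
    by (rule has_sum_imp_summable, rule has_sum_finite_neutralI[of "{1}"]) auto
  ultimately show ?case by simp
next
  case (Suc l)
  have eq: "of_nat (dirichlet_power \<phi> (Suc l) n) * x n =
      of_nat (dirichlet_conv (dirichlet_power \<phi> l) \<phi> n) * x n" if "n \<in> {1..}" for n
    using that by (simp add: dirichlet_power_Suc_conv del: dirichlet_power.simps)
  have "(\<lambda>n. of_nat (dirichlet_conv (dirichlet_power \<phi> l) \<phi> n) * x n) abs_summable_on {1..}"
    using Suc.IH by (intro abs_summable_conv mult \<phi>) auto
  moreover have "((\<lambda>n. of_nat (dirichlet_conv (dirichlet_power \<phi> l) \<phi> n) * x n) has_sum a ^ l * a) {1..}"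
    using Suc.IH by (intro has_sum_conv mult \<phi>) auto
  moreover have "(\<lambda>n. of_nat (dirichlet_power \<phi> (Suc l) n) * x n) abs_summable_on {1..} \<longleftrightarrow>
      (\<lambda>n. of_nat (dirichlet_conv (dirichlet_power \<phi> l) \<phi> n) * x n) abs_summable_on {1..}"
    by (intro summable_on_cong) (simp only: eq)
  moreover have "((\<lambda>n. of_nat (dirichlet_power \<phi> (Suc l) n) * x n) has_sum a ^ l * a) {1..} \<longleftrightarrow>
      ((\<lambda>n. of_nat (dirichlet_conv (dirichlet_power \<phi> l) \<phi> n) * x n) has_sum a ^ l * a) {1..}"
    by (intro has_sum_cong) (simp only: eq)
  ultimately show ?case by (simp only: power_Suc2)
qed

text \<open>
  The sum over multisets is collected according to the product of the multiset. The subtracted 1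
  is the contribution of the empty factorization of 1.
\<close>

lemma has_sum_factorizations:
  fixes x :: "nat \<Rightarrow> 'a::{real_normed_field,banach}"
  assumes one: "x 1 = 1" and mult: "\<And>m n. x (m * n) = x m * x n"
    and x: "\<And>d. d \<ge> 2 \<Longrightarrow> norm (x d) < 1" and sm: "summable (\<lambda>k. norm (x (k + 2)))"
  shows "((\<lambda>n. of_nat (truncate_one num_factorizations n) * x n) has_sum
    (\<Prod>k. inverse (1 - x (k + 2))) - 1) {1..}"
proof -
  let ?P = "\<Prod>k. inverse (1 - x (k + 2))"
  have w: "prod_mset (image_mset x M) = x (prod_mset M)" for M
    by (induction M) (simp_all add: one[simplified] mult)
  have bij: "bij_betw snd (Sigma {1..} factorizations) {M. set_mset M \<subseteq> {2..}}"
  proof (rule bij_betw_byWitness[where f' = "\<lambda>M. (prod_mset M, M)"])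
    have "prod_mset M \<ge> 1" if "set_mset M \<subseteq> {2..}" for M :: "nat multiset"
    proof -
      have "\<forall>d\<in>#M. 2 \<le> id d" using that by auto
      from two_power_size_le_prod[OF this] have "2 ^ size M \<le> prod_mset M" by simp
      then show ?thesis using one_le_power[of "2::nat" "size M"] by linarith
    qed
    then show "(\<lambda>M. (prod_mset M, M)) ` {M. set_mset M \<subseteq> {2..}} \<subseteq> Sigma {1..} factorizations"
      by (auto simp: factorizations_def)
  qed (auto simp: factorizations_def)
  have "((\<lambda>M. x (prod_mset M)) has_sum ?P) {M. set_mset M \<subseteq> {2..}}"
    using euler_product[of x] x sm by (simp add: w)
  then have "((\<lambda>p. x (prod_mset (snd p))) has_sum ?P) (Sigma {1..} factorizations)"
    using has_sum_reindex_bij_betw[OF bij, of "\<lambda>M. x (prod_mset M)"] by simp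
  then have all: "((\<lambda>n. of_nat (num_factorizations n) * x n) has_sum ?P) {1..}"
  proof (rule has_sum_SigmaD)
    fix n :: nat assume "n \<in> {1..}"
    then have "finite (factorizations n)" by (simp add: finite_factorizations)
    moreover have "(\<Sum>M\<in>factorizations n. x (prod_mset M)) = of_nat (num_factorizations n) * x n"
      by (simp add: num_factorizations_def factorizations_def)
    ultimately show "((\<lambda>M. x (prod_mset (snd (n, M)))) has_sum
        of_nat (num_factorizations n) * x n) (factorizations n)"
      by (simp add: has_sum_finiteI)
  qed
  have "M = {#}" if "M \<in> factorizations 1" for M
    using that prod_ge_2[of M id] by (force simp: factorizations_def)
  then have "factorizations 1 = {{#}}" by (auto simp: factorizations_def)
  then have "((\<lambda>n. of_nat (num_factorizations n) * x n) has_sum 1) {1}"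
    using one by (intro has_sum_finiteI) (simp_all add: num_factorizations_def)
  from has_sum_Diff[OF all this]
  have "((\<lambda>n. of_nat (num_factorizations n) * x n) has_sum ?P - 1) ({1..} - {1})"
    by simp
  also have "?this \<longleftrightarrow> ?thesis"
    by (rule has_sum_cong_neutral) (auto simp: truncate_one_def)
  finally show ?thesis .
qed

lemma has_sum_colored:
  fixes x :: "nat \<Rightarrow> 'a::{real_normed_field,banach}"
  assumes one: "x 1 = 1" and mult: "\<And>m n. x (m * n) = x m * x n"
    and x: "\<And>d. d \<ge> 2 \<Longrightarrow> norm (x d) < 1" and sm: "summable (\<lambda>k. norm (x (k + 2)))"
    and l: "l \<ge> 1"
  shows "((\<lambda>n. of_nat (num_colored l n) * x n) has_sum
    ((\<Prod>k. inverse (1 - x (k + 2))) - 1) ^ l) {1..}"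
proof -
  let ?F = "truncate_one num_factorizations"
  have "((\<lambda>n. of_nat (?F n) * norm (x n)) has_sum
      (\<Prod>k. inverse (1 - norm (x (k + 2)))) - 1) {1..}"
    using one mult x sm by (intro has_sum_factorizations) (auto simp: norm_mult)
  then have abs: "(\<lambda>n. norm (of_nat (?F n) * x n)) summable_on {1..}"
    by (simp add: norm_mult has_sum_imp_summable)
  have "((\<lambda>n. of_nat (dirichlet_power ?F l n) * x n) has_sum
      ((\<Prod>k. inverse (1 - x (k + 2))) - 1) ^ l) {1..}"
    using has_sum_dirichlet_power[OF one mult abs has_sum_factorizations[OF one mult x sm]] by blast
  then show ?thesis
    by (rule has_sum_cong[THEN iffD1, rotated]) (simp add: num_colored_eq_power(1)[OF l])
qed

theorem mainTheorem8:
  fixes l :: nat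
  assumes "l \<ge> 1"
  shows "(\<forall>s::complex. Re s > 1 \<longrightarrow>
            convergent_prod (\<lambda>k. inverse (1 - of_nat (k + 2) powr (- s))) \<and>
            (\<lambda>k. of_nat (num_colored l (k + 1)) * of_nat (k + 1) powr (- s)) sums
              ((\<Prod>k. inverse (1 - of_nat (k + 2) powr (- s))) - 1) ^ l) \<and>
         (\<forall>n\<ge>1. num_colored l n = dirichlet_power (truncate_one num_factorizations) l n) \<and>
         (\<forall>n\<ge>1. num_distinct_colored l n =
                    dirichlet_power (truncate_one num_distinct_factorizations) l n)"
proof (intro conjI allI impI)
  fix s :: complex assume s: "Re s > 1"
  define x where "x n = (of_nat n :: complex) powr (- s)" for n :: nat
  have norm_x: "norm (x n) = real n powr (- Re s)" for n
    by (simp add: x_def norm_powr_real_powr)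
  have one: "x 1 = 1" by (simp add: x_def)
  have mult: "x (m * n) = x m * x n" for m n
    by (simp add: x_def powr_times_real)
  have lt: "norm (x d) < 1" if "d \<ge> 2" for d
    unfolding norm_x using that s by (intro powr_less_one) auto
  have "summable (\<lambda>n. norm (x n))"
    unfolding norm_x using s by (simp add: summable_real_powr_iff)
  then have sm: "summable (\<lambda>k. norm (x (k + 2)))"
    by (rule summable_ignore_initial_segment)
  show "convergent_prod (\<lambda>k. inverse (1 - of_nat (k + 2) powr (- s)))"
    using convergent_prod_euler[OF sm] by (simp only: x_def)
  have "bij_betw (\<lambda>k. k + 1) UNIV {1::nat..}"
    by (rule bij_betw_byWitness[where f' = "\<lambda>n. n - 1"]) auto
  from has_sum_reindex_bij_betw[OF this, of "\<lambda>n. of_nat (num_colored l n) * x n"]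
    has_sum_colored[OF one mult lt sm assms]
  have "((\<lambda>k. of_nat (num_colored l (k + 1)) * x (k + 1)) has_sum
      ((\<Prod>k. inverse (1 - x (k + 2))) - 1) ^ l) UNIV"
    by simp
  from has_sum_imp_sums[OF this]
  show "(\<lambda>k. of_nat (num_colored l (k + 1)) * of_nat (k + 1) powr (- s)) sums
      ((\<Prod>k. inverse (1 - of_nat (k + 2) powr (- s))) - 1) ^ l"
    by (simp only: x_def)
qed (use assms num_colored_eq_power in auto)

end
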